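(* For all integers $n\geq 1$: (a) $\mathrm{num}(n,-1)=n!$; (b) $\lvert\mathrm{num}(n,\mathrm{i})\rvert=\lvert\mathrm{num}(n,-\mathrm{i})\rvert=2^{\lfloor n/2\rfloor}\lfloor n/2\rfloor!$, where $\mathrm{i}$ is the imaginary unit; (c) for a primitive sixth root of unity $\zeta_6$, \[\lvert\mathrm{num}(n,\zeta_6)\rvert=\begin{cases}3^{\lfloor n/3\rfloor}\lfloor n/3\rfloor! & n\not\equiv 2 \pmod 3,\\ 4\cdot 3^{\lfloor n/3\rfloor}\lfloor n/3\rfloor! & n\equiv 2\pmod 3.\end{cases}\]
   Context: For a partition $\lambda$ of $n$ (written $\lambda\vdash n$) let $m_\lambda(i)$ be the number of parts of $\lambda$ equal to $i$. Define $h_\lambda(x)=\prod_{i\geq 1}(1+x^i)^{\lfloor n/i\rfloor-m_\lambda(i)}$, $\mathrm{num}^*(n,x)=\sum_{\lambda\vdash n}h_\lambda(x)$, $\mathrm{den}^*(n,x)=\prod_{i\geq1}(1+x^i)^{\lfloor n/i\rfloor}$ (so that $\sum_{\lambda\vdash n}\prod_{j}(1+x^{\lambda_j})^{-1}=\mathrm{num}^*(n,x)/\mathrm{den}^*(n,x)$). Let $G(n,x)=\gcd\{h_\lambda(x)\mid\lambda\vdash n\}$ (the monic gcd in $\mathbb{Z}[x]$), and set $\mathrm{num}(n,x)=\mathrm{num}^*(n,x)/G(n,x)$ and $\mathrm{den}(n,x)=\mathrm{den}^*(n,x)/G(n,x)$. *)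

theory Defs
  imports
    Complex_Main
    "HOL-Library.Multiset"
    "HOL-Computational_Algebra.Computational_Algebra"
begin

text \<open>Partitions are the multisets of their (positive) parts, so that the multiplicity
  \<open>m\<^sub>p(i)\<close> is \<^term>\<open>count p i\<close>.\<close>

definition partitions :: "nat \<Rightarrow> nat multiset set" where
  "partitions n = {p. (\<forall>i \<in># p. 1 \<le> i) \<and> sum_mset p = n}"

text \<open>All factors with \<open>i > n\<close> are 1. For a partition \<open>p\<close> of \<open>n\<close> and
  \<open>i \<ge> 1\<close> one has \<open>i * count p i \<le> n\<close>, so the subtraction in
  the exponent does not truncate.\<close>

definition h_poly :: "nat \<Rightarrow> nat multiset \<Rightarrow> int poly" where
  "h_poly n p = (\<Prod>i=1..n. (1 + monom 1 i) ^ (n div i - count p i))"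

definition num_star :: "nat \<Rightarrow> int poly" where
  "num_star n = (\<Sum>p\<in>partitions n. h_poly n p)"

text \<open>The library's \<^const>\<open>Gcd\<close> on \<^typ>\<open>int poly\<close> is normalized to have positive
  leading coefficient; as it divides the monic polynomials \<^const>\<open>h_poly\<close>, it is the monic gcd.\<close>

definition G_poly :: "nat \<Rightarrow> int poly" where
  "G_poly n = Gcd (h_poly n ` partitions n)"

text \<open>The division is exact, since \<^const>\<open>G_poly\<close> divides every summand of
  \<^const>\<open>num_star\<close>.\<close>

definition num_poly :: "nat \<Rightarrow> int poly" where
  "num_poly n = num_star n div G_poly n"

definition num_at :: "nat \<Rightarrow> complex \<Rightarrow> complex" where
  "num_at n z = poly (map_poly of_int (num_poly n)) z"

definition primitive_root_of_unity :: "nat \<Rightarrow> complex \<Rightarrow> bool" where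
  "primitive_root_of_unity m z \<longleftrightarrow> m > 0 \<and> z ^ m = 1 \<and> (\<forall>k. 0 < k \<and> k < m \<longrightarrow> z ^ k \<noteq> 1)"

end

theory Submission
  imports Defs
begin

text \<open>
  Grouping \<open>\<Prod>\<^sub>i (1 + x\<^sup>i)\<^bsup>\<lfloor>n/i\<rfloor>\<^esup>\<close> as \<open>\<Prod>\<^sub>j \<Prod>\<^sub>i\<^sub>|\<^sub>j (1 + x\<^sup>i)\<close> (\<open>j \<le> n\<close>) and keeping, for each
  \<open>j\<close>, only the \<open>i\<close> for which \<open>j/i\<close> is a power of 2 yields a polynomial \<open>L\<close>, each of whose \<open>n\<close>
  factors telescopes to \<open>(x\<^bsup>2j\<^esup> - 1)/(x\<^sup>m - 1)\<close> with \<open>m\<close> the odd part of \<open>j\<close>. Let \<open>e\<close> be minimal with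
  \<open>z\<^sup>e = -1\<close>. Then \<open>L\<close> vanishes at \<open>z\<close> to order \<open>\<lfloor>n/e\<rfloor>\<close>, and this is also the maximal order at
  \<open>z\<close> of \<open>\<Prod>\<^sub>k (1 + x\<^bsup>p\<^sub>k\<^esup>)\<close> over all partitions \<open>p\<close> of \<open>n\<close>. Hence \<open>L\<close> is the reduced
  denominator and the omitted factors multiply to the gcd.

  The partitions that contribute to the numerator at \<open>z\<close> attain this maximum: they consist of
  \<open>\<lfloor>n/e\<rfloor>\<close> parts \<open>e\<close> and a partition of \<open>n mod e\<close>. The value at \<open>z\<close> is therefore an explicit product
  over \<open>j \<le> n\<close>, where the factors with \<open>e | j\<close>, which have a simple zero at \<open>z\<close>, enter through
  their derivatives. The three claims are the cases \<open>e = 1, 2, 3\<close>.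
\<close>

section \<open>Integer and complex polynomials\<close>

abbreviation cpoly :: "int poly \<Rightarrow> complex poly" where
  "cpoly \<equiv> map_poly of_int"

lemma cpoly_mult: "cpoly (p * q) = cpoly p * cpoly q"
  by (rule poly_eqI) (simp add: coeff_map_poly coeff_mult)

lemma cpoly_add: "cpoly (p + q) = cpoly p + cpoly q"
  by (rule poly_eqI) (simp add: coeff_map_poly)

lemma cpoly_sum: "cpoly (\<Sum>x\<in>A. f x) = (\<Sum>x\<in>A. cpoly (f x))"
  by (induction A rule: infinite_finite_induct) (simp_all add: cpoly_add)

lemma cpoly_prod: "cpoly (\<Prod>x\<in>A. f x) = (\<Prod>x\<in>A. cpoly (f x))"
  by (induction A rule: infinite_finite_induct) (simp_all add: cpoly_mult)

lemma cpoly_eq_0_iff: "cpoly p = 0 \<longleftrightarrow> p = 0"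
  by (auto simp: poly_eq_iff coeff_map_poly)

lemma degree_cpoly: "degree (cpoly p) = degree p"
  by (simp add: degree_map_poly)

lemma poly_cpoly_of_int: "poly (cpoly p) (of_int x) = of_int (poly p x)"
  by (induction p) (simp_all add: map_poly_pCons)

text \<open>Pseudo-division by a monic \<open>g\<close> is true division over the integers. Over the
  complex numbers \<open>g\<close> divides the remainder, whose degree is too small unless it is 0.
  This allows divisibility in \<open>int poly\<close> to be checked by comparing orders of complex
  zeros.\<close>

lemma monic_dvd_if_cpoly_dvd:
  assumes "lead_coeff g = 1" and "cpoly g dvd cpoly f"
  shows "g dvd f"
proof -
  obtain q r where qr: "pseudo_divmod f g = (q, r)"
    by fastforce
  have "g \<noteq> 0"
    using assms(1) by auto
  with qr have f: "f = g * q + r" and r: "r = 0 \<or> degree r < degree g"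
    using pseudo_divmod[of g f q r] assms(1) by auto
  have "cpoly g dvd cpoly r"
    using assms(2) unfolding f cpoly_add cpoly_mult
    by (metis dvd_add_right_iff dvd_triv_left)
  hence "r = 0"
    using r dvd_imp_degree_le[of "cpoly g" "cpoly r"]
    by (metis cpoly_eq_0_iff degree_cpoly not_less)
  thus ?thesis
    by (simp add: f)
qed

lemma complex_dvd_if_order_le:
  fixes p q :: "complex poly"
  assumes "p \<noteq> 0" "q \<noteq> 0" "\<And>z. order z p \<le> order z q"
  shows "p dvd q"
proof -
  have sub: "proots p \<subseteq># proots q"
    using assms by (intro mset_subset_eqI) simp
  have "(\<Prod>x\<in>#proots p. [:- x, 1:]) dvd (\<Prod>x\<in>#proots q. [:- x, 1:])"
    using sub by (intro prod_mset_subset_imp_dvd image_mset_subseteq_mono)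
  hence "smult (lead_coeff p) (\<Prod>x\<in>#proots p. [:- x, 1:]) dvd
      smult (lead_coeff q) (\<Prod>x\<in>#proots q. [:- x, 1:])"
    using assms(1,2) by (simp add: smult_dvd_iff dvd_smult_iff dvd_smult)
  thus ?thesis
    by (simp only: complex_poly_decompose_multiset)
qed

lemma order_prod:
  fixes f :: "'b \<Rightarrow> 'a::idom poly"
  assumes "\<And>x. x \<in> A \<Longrightarrow> f x \<noteq> 0"
  shows "order z (\<Prod>x\<in>A. f x) = (\<Sum>x\<in>A. order z (f x))"
  using assms
  by (induction A rule: infinite_finite_induct) (auto simp: order_mult)

section \<open>The factors $1 + x^i$\<close>

abbreviation xp1 :: "nat \<Rightarrow> 'a::comm_ring_1 poly" where
  "xp1 i \<equiv> 1 + monom 1 i"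

lemma cpoly_xp1 [simp]: "cpoly (xp1 i) = xp1 i"
  by (simp add: cpoly_add map_poly_monom)

lemma lead_coeff_xp1:
  assumes "i \<ge> 1"
  shows "lead_coeff (xp1 i :: 'a::idom poly) = 1"
proof -
  have "degree (xp1 i :: 'a poly) = i"
    using assms by (subst degree_add_eq_right) (auto simp: degree_monom_eq)
  thus ?thesis
    using assms by (simp add: coeff_eq_0)
qed

lemma xp1_nonzero:
  assumes "i \<ge> 1"
  shows "xp1 i \<noteq> (0 :: 'a::idom poly)"
  using lead_coeff_xp1[OF assms, where ?'a = 'a] by (metis coeff_0 zero_neq_one)

lemma order_1_if_poly_pderiv_nonzero:
  fixes p :: "complex poly"
  assumes "poly p z = 0" "poly (pderiv p) z \<noteq> 0"
  shows "order z p = 1"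
proof -
  have "p \<noteq> 0"
    using assms(2) by auto
  moreover have "order z (pderiv p) = 0"
    using assms(2) by (rule order_0I)
  ultimately show ?thesis
    using assms(1) order_pderiv[of p z] order_root[of p z] by (auto simp: pderiv_eq_0_iff)
qed

text \<open>The derivative \<open>i * z ^ (i - 1)\<close> does not vanish at a zero of
  \<open>xp1 i\<close>, so all zeros are simple.\<close>

lemma order_xp1:
  fixes z :: complex
  assumes "i \<ge> 1"
  shows "order z (xp1 i) = of_bool (z ^ i = -1)"
proof (cases "z ^ i = -1")
  case True
  hence "z \<noteq> 0"
    using assms by (auto simp: power_0_left)
  have "order z (xp1 i) = 1"
  proof (rule order_1_if_poly_pderiv_nonzero)
    show "poly (xp1 i) z = 0"
      using True by (simp add: poly_monom)
    show "poly (pderiv (xp1 i)) z \<noteq> 0"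
      using assms \<open>z \<noteq> 0\<close> by (simp add: pderiv_add pderiv_monom poly_monom)
  qed
  thus ?thesis
    using True by simp
next
  case False
  hence "poly (xp1 i) z \<noteq> 0"
    by (simp add: poly_monom eq_neg_iff_add_eq_0 add.commute)
  thus ?thesis
    using False by (simp add: order_0I)
qed

section \<open>Minimal exponents with $z^e = -1$\<close>

text \<open>Equivalently, \<open>z\<close> is a primitive root of unity of order
  \<open>2 * e\<close>. The form chosen here speaks directly about the zeros of the factors
  \<open>xp1 i\<close>.\<close>

definition least_neg1 :: "complex \<Rightarrow> nat \<Rightarrow> bool" where
  "least_neg1 z e \<longleftrightarrow> e \<ge> 1 \<and> z ^ e = -1 \<and> (\<forall>i. 1 \<le> i \<and> i < e \<longrightarrow> z ^ i \<noteq> -1)"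

lemma least_neg1_exists:
  assumes "i \<ge> 1" "z ^ i = -1"
  shows "\<exists>e. least_neg1 z e"
proof -
  let ?P = "\<lambda>i. i \<ge> 1 \<and> z ^ i = -1"
  have "?P (LEAST i. ?P i)"
    using assms by (intro LeastI[of ?P i]) auto
  moreover have "\<not> ?P k" if "k < (LEAST i. ?P i)" for k
    using not_less_Least[OF that] by blast
  ultimately show ?thesis
    unfolding least_neg1_def by blast
qed

lemma least_neg1_power_mod:
  assumes "least_neg1 z e"
  shows "z ^ k = (-1) ^ (k div e) * z ^ (k mod e)"
proof -
  have "z ^ k = z ^ (e * (k div e) + k mod e)"
    by simp
  also have "\<dots> = (z ^ e) ^ (k div e) * z ^ (k mod e)"
    by (simp only: power_add power_mult)
  also have "z ^ e = -1"
    using assms by (simp add: least_neg1_def)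
  finally show ?thesis .
qed

text \<open>If \<open>z ^ r = 1\<close> with \<open>0 < r < e\<close>, then
  \<open>z ^ (e - r) = -1\<close> contradicts the minimality of \<open>e\<close>.\<close>

lemma least_neg1_remainder:
  assumes e: "least_neg1 z e" and "r < e" and "z ^ r = 1 \<or> z ^ r = -1"
  shows "r = 0"
proof (rule ccontr)
  assume "r \<noteq> 0"
  hence r: "z ^ r = 1"
    using assms unfolding least_neg1_def by auto
  have "z ^ (e - r) * z ^ r = -1"
    using assms by (simp flip: power_add) (simp add: least_neg1_def)
  hence "z ^ (e - r) = -1"
    using r by simp
  moreover have "1 \<le> e - r" "e - r < e"
    using \<open>r < e\<close> \<open>r \<noteq> 0\<close> by auto
  ultimately show False
    using e unfolding least_neg1_def by blast
qed

lemma least_neg1_power_eq_pm1_iff: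
  assumes "least_neg1 z e"
  shows "z ^ k = 1 \<or> z ^ k = -1 \<longleftrightarrow> e dvd k"
proof
  assume "z ^ k = 1 \<or> z ^ k = -1"
  hence "z ^ (k mod e) = 1 \<or> z ^ (k mod e) = -1"
    unfolding least_neg1_power_mod[OF assms, of k]
    by (cases "even (k div e)") (auto simp: minus_equation_iff[of _ 1])
  moreover have "k mod e < e"
    using assms by (simp add: least_neg1_def)
  ultimately show "e dvd k"
    using least_neg1_remainder[OF assms] by (auto simp: mod_eq_0_iff_dvd)
next
  assume "e dvd k"
  thus "z ^ k = 1 \<or> z ^ k = -1"
    using least_neg1_power_mod[OF assms, of k] by (cases "even (k div e)") auto
qed

lemma least_neg1_power_double_eq_1_iff:
  assumes "least_neg1 z e"
  shows "z ^ (2 * k) = 1 \<longleftrightarrow> e dvd k"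
  using least_neg1_power_eq_pm1_iff[OF assms, of k]
  by (simp add: power_mult mult.commute[of 2] power2_eq_1_iff)

text \<open>The order of \<open>z\<close> is even. This keeps the denominator
  \<open>z ^ m - 1\<close> of the telescoped quotient nonzero.\<close>

lemma least_neg1_odd_power:
  assumes "least_neg1 z e" "odd k"
  shows "z ^ k \<noteq> 1"
proof
  assume k: "z ^ k = 1"
  hence "e dvd k"
    using least_neg1_power_eq_pm1_iff[OF assms(1)] by blast
  hence "odd (k div e)" "k mod e = 0"
    using assms(2) by (metis dvd_mult_div_cancel even_mult_iff, simp)
  thus False
    using k least_neg1_power_mod[OF assms(1), of k] by simp
qed

lemma power_neg1_least_neg1_dvd:
  assumes "least_neg1 z e" "z ^ k = -1"
  shows "e dvd k"
  using least_neg1_power_eq_pm1_iff[OF assms(1)] assms(2) by blast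

section \<open>The reduced denominator\<close>

text \<open>In the notation of the introduction, \<open>red_den\<close> is \<open>L\<close>, \<open>cofactor\<close> will turn out to be
  the gcd, and \<open>chain_poly j\<close> is the factor of \<open>L\<close> belonging to \<open>j\<close>.\<close>

definition pow2_chain :: "nat \<Rightarrow> nat set" where
  "pow2_chain j = {i. \<exists>k. j = i * 2 ^ k}"

definition chain_poly :: "nat \<Rightarrow> 'a::comm_ring_1 poly" where
  "chain_poly j = (\<Prod>i\<in>pow2_chain j. xp1 i)"

definition red_den :: "nat \<Rightarrow> 'a::comm_ring_1 poly" where
  "red_den n = (\<Prod>j=1..n. chain_poly j)"

definition cofactor :: "nat \<Rightarrow> 'a::comm_ring_1 poly" where
  "cofactor n = (\<Prod>j=1..n. \<Prod>i\<in>{i. i dvd j} - pow2_chain j. xp1 i)"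

definition part_poly :: "nat multiset \<Rightarrow> 'a::comm_ring_1 poly" where
  "part_poly p = (\<Prod>i\<in>#p. xp1 i)"

lemma pow2_chain_subset: "pow2_chain j \<subseteq> {i. i dvd j}"
  by (auto simp: pow2_chain_def)

lemma finite_pow2_chain: "j \<ge> 1 \<Longrightarrow> finite (pow2_chain j)"
  by (rule finite_subset[OF pow2_chain_subset]) simp

lemma pow2_chain_pos: "j \<ge> 1 \<Longrightarrow> i \<in> pow2_chain j \<Longrightarrow> i \<ge> 1"
  by (cases i) (auto simp: pow2_chain_def)

lemma pow2_chain_odd:
  assumes "odd j"
  shows "pow2_chain j = {j}"
proof -
  have "k = 0" if "j = i * 2 ^ k" for i k
    using assms that by (cases k) auto
  thus ?thesis
    by (fastforce simp: pow2_chain_def intro: exI[of _ 0])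
qed

lemma pow2_chain_double: "pow2_chain (2 * j) = insert (2 * j) (pow2_chain j)"
proof (intro equalityI subsetI)
  fix i assume "i \<in> pow2_chain (2 * j)"
  then obtain k where "2 * j = i * 2 ^ k"
    by (auto simp: pow2_chain_def)
  thus "i \<in> insert (2 * j) (pow2_chain j)"
    by (cases k) (auto simp: pow2_chain_def)
next
  fix i assume "i \<in> insert (2 * j) (pow2_chain j)"
  thus "i \<in> pow2_chain (2 * j)"
    by (auto simp: pow2_chain_def intro: exI[of _ 0] exI[of _ "Suc _"])
qed

lemma chain_poly_odd: "odd j \<Longrightarrow> chain_poly j = xp1 j"
  by (simp add: chain_poly_def pow2_chain_odd)

text \<open>Passing from \<open>t\<close> to \<open>2 * t\<close> adds the single factor
  \<open>xp1 (2 * t)\<close> to the chain, and \<open>xp1 i\<close> times \<open>x^i - 1\<close> is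
  \<open>x^(2i) - 1\<close>. The induction ends at the odd part \<open>m\<close>. The identity is
  multiplied out so that it can be evaluated and differentiated without division.\<close>

lemma chain_poly_telescope:
  assumes "j \<ge> 1"
  shows "\<exists>m k. odd m \<and> j = m * 2 ^ k \<and>
    chain_poly j * (monom 1 m - 1) = (monom 1 (2 * j) - 1 :: 'a::comm_ring_1 poly)"
  using assms
proof (induction j rule: less_induct)
  case (less j)
  have sq: "xp1 i * (monom 1 i - 1) = (monom 1 (2 * i) - 1 :: 'a poly)" for i
    by (simp add: algebra_simps mult_monom flip: mult_2_right)
  show ?case
  proof (cases "odd j")
    case True
    thus ?thesis
      using sq[of j] by (intro exI[of _ j] exI[of _ 0]) (simp add: chain_poly_odd)
  next
    case False
    then obtain t where t: "j = 2 * t"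
      by (auto elim: evenE)
    with less.prems have "t \<ge> 1" "t < j"
      by auto
    then obtain m k where mk: "odd m" "t = m * 2 ^ k"
      "chain_poly t * (monom 1 m - 1) = (monom 1 (2 * t) - 1 :: 'a poly)"
      using less.IH by blast
    have "j \<notin> pow2_chain t"
      using \<open>t < j\<close> \<open>t \<ge> 1\<close> pow2_chain_subset[of t] by (fastforce dest: dvd_imp_le)
    hence "chain_poly j = xp1 j * (chain_poly t :: 'a poly)"
      using finite_pow2_chain[OF \<open>t \<ge> 1\<close>] by (simp add: chain_poly_def t pow2_chain_double)
    hence "chain_poly j * (monom 1 m - 1) = (monom 1 (2 * j) - 1 :: 'a poly)"
      using mk(3) sq[of j] by (simp only: mult.assoc t)
    thus ?thesis
      using mk(1,2) t by (intro exI[of _ m] exI[of _ "Suc k"]) simp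
  qed
qed

lemma multiples_eq_image:
  fixes i :: nat
  assumes "i \<ge> 1"
  shows "{j\<in>{1..n}. i dvd j} = (*) i ` {1..n div i}"
proof (intro equalityI subsetI)
  fix j assume "j \<in> {j\<in>{1..n}. i dvd j}"
  then obtain k where "j = i * k" "1 \<le> j" "j \<le> n"
    by auto
  thus "j \<in> (*) i ` {1..n div i}"
    using assms by (auto simp: less_eq_div_iff_mult_less_eq mult.commute Suc_le_eq)
next
  fix j assume "j \<in> (*) i ` {1..n div i}"
  thus "j \<in> {j\<in>{1..n}. i dvd j}"
    using assms by (auto simp: less_eq_div_iff_mult_less_eq mult.commute Suc_le_eq)
qed

lemma card_multiples:
  assumes "i \<ge> 1"
  shows "card {j\<in>{1..n}. i dvd j} = n div i"
proof -
  have "inj_on ((*) i) {1..n div i}"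
    using assms by (auto simp: inj_on_def)
  thus ?thesis
    unfolding multiples_eq_image[OF assms] by (simp add: card_image)
qed

text \<open>Double counting of the pairs \<open>i dvd j\<close> with \<open>j \<le> n\<close>: for
  fixed \<open>j\<close> the divisors split into the chain and the rest, and each fixed
  \<open>i\<close> has \<open>n div i\<close> multiples.\<close>

lemma red_den_times_cofactor:
  "red_den n * cofactor n = (\<Prod>i=1..n. xp1 i ^ (n div i) :: 'a::comm_ring_1 poly)"
proof -
  have "red_den n * cofactor n = (\<Prod>j=1..n. \<Prod>i | i dvd j. xp1 i :: 'a poly)"
    unfolding red_den_def cofactor_def chain_poly_def prod.distrib[symmetric]
  proof (rule prod.cong)
    fix j assume "j \<in> {1..n}"
    thus "(\<Prod>i\<in>pow2_chain j. xp1 i) * (\<Prod>i\<in>{i. i dvd j} - pow2_chain j. xp1 i) =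
        (\<Prod>i | i dvd j. xp1 i :: 'a poly)"
      using pow2_chain_subset[of j] by (subst mult.commute) (simp add: prod.subset_diff)
  qed simp
  also have "\<dots> = (\<Prod>j=1..n. \<Prod>i\<in>{i\<in>{1..n}. i dvd j}. xp1 i)"
  proof (rule prod.cong)
    fix j assume "j \<in> {1..n}"
    hence "{i. i dvd j} = {i\<in>{1..n}. i dvd j}"
      by (auto dest: dvd_imp_le intro: Suc_leI dvd_pos_nat)
    thus "(\<Prod>i | i dvd j. xp1 i) = (\<Prod>i\<in>{i\<in>{1..n}. i dvd j}. xp1 i :: 'a poly)"
      by simp
  qed simp
  also have "\<dots> = (\<Prod>i=1..n. \<Prod>j\<in>{j\<in>{1..n}. i dvd j}. xp1 i)"
    by (rule prod.swap_restrict) auto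
  also have "\<dots> = (\<Prod>i=1..n. xp1 i ^ (n div i))"
  proof (rule prod.cong)
    fix i assume "i \<in> {1..n}"
    thus "(\<Prod>j\<in>{j\<in>{1..n}. i dvd j}. xp1 i) = (xp1 i ^ (n div i) :: 'a poly)"
      using card_multiples[of i n] by (simp only: prod_constant atLeastAtMost_iff)
  qed simp
  finally show ?thesis .
qed

section \<open>Partitions and their products of factors\<close>

lemma finite_partitions: "finite (partitions n)"
proof (induction n rule: less_induct)
  case (less n)
  have "partitions n \<subseteq> insert {#} (\<Union>i\<in>{1..n}. add_mset i ` partitions (n - i))"
  proof
    fix p assume p: "p \<in> partitions n"
    show "p \<in> insert {#} (\<Union>i\<in>{1..n}. add_mset i ` partitions (n - i))"
    proof (cases p)
      case (add i q)
      hence "i \<in> {1..n}" "q \<in> partitions (n - i)"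
        using p by (auto simp: partitions_def)
      thus ?thesis
        using add by blast
    qed simp
  qed
  moreover have "finite (partitions (n - i))" if "i \<in> {1..n}" for i
    using less that by simp
  ultimately show ?case
    by (auto intro: finite_subset)
qed

lemma count_mult_le_sum_mset: "count p i * i \<le> sum_mset (p :: nat multiset)"
  by (induction p) auto

text \<open>Combined with \<open>red_den_times_cofactor\<close>, this reduces questions about
  \<open>h_poly\<close> to questions about \<open>part_poly\<close>.\<close>

lemma h_poly_times_part_poly:
  assumes "p \<in> partitions n"
  shows "h_poly n p * part_poly p = (\<Prod>i=1..n. xp1 i ^ (n div i))"
proof -
  have pos: "i \<ge> 1" if "i \<in># p" for i
    using assms that by (auto simp: partitions_def)
  have sum: "sum_mset p = n"
    using assms by (simp add: partitions_def)
  have "set_mset p \<subseteq> {1..n}"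
    using pos sum by (auto dest!: multi_member_split)
  hence "part_poly p = (\<Prod>i=1..n. xp1 i ^ count p i :: int poly)"
    unfolding part_poly_def image_prod_mset_multiplicity
    by (intro prod.mono_neutral_left) (auto simp: not_in_iff)
  moreover have "n div i - count p i + count p i = n div i" if "i \<in> {1..n}" for i
    using that count_mult_le_sum_mset[of p i] sum by (simp add: less_eq_div_iff_mult_less_eq)
  ultimately show ?thesis
    by (simp add: h_poly_def flip: prod.distrib power_add)
qed

section \<open>Orders of vanishing\<close>

text \<open>Differentiating the telescoped identity at \<open>z\<close> leaves a single term on the
  left, because \<open>chain_poly j\<close> itself vanishes there.\<close>

lemma chain_poly_deriv:
  fixes z :: complex
  assumes "least_neg1 z e" "j \<ge> 1" "e dvd j"
    and "chain_poly j * (monom 1 m - 1) = (monom 1 (2 * j) - 1 :: complex poly)" "odd m"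
  shows "poly (chain_poly j) z = 0"
    and "poly (pderiv (chain_poly j)) z * (z ^ m - 1) = 2 * of_nat j * z ^ (2 * j - 1)"
proof -
  have "poly (chain_poly j) z * (z ^ m - 1) = z ^ (2 * j) - 1"
    using arg_cong[OF assms(4), of "\<lambda>p. poly p z"] by (simp add: poly_monom)
  thus 0: "poly (chain_poly j) z = 0"
    using least_neg1_odd_power[OF assms(1,5)] least_neg1_power_double_eq_1_iff[OF assms(1), of j]
      assms(3) by simp
  show "poly (pderiv (chain_poly j)) z * (z ^ m - 1) = 2 * of_nat j * z ^ (2 * j - 1)"
    using arg_cong[OF assms(4), of "\<lambda>p. poly (pderiv p) z"] 0
    by (simp add: poly_monom pderiv_mult pderiv_diff pderiv_monom mult.commute)
qed

lemma least_neg1_nonzero: "least_neg1 z e \<Longrightarrow> z \<noteq> 0"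
  by (auto simp: least_neg1_def power_0_left)

lemma chain_poly_nonzero: "j \<ge> 1 \<Longrightarrow> chain_poly j \<noteq> (0 :: 'a::idom poly)"
  unfolding chain_poly_def
  using pow2_chain_pos finite_pow2_chain xp1_nonzero by (metis prod_zero_iff)

lemma order_chain_poly:
  fixes z :: complex
  assumes e: "least_neg1 z e" and j: "j \<ge> 1"
  shows "order z (chain_poly j) = of_bool (e dvd j)"
proof -
  obtain m k where m: "odd m"
    "chain_poly j * (monom 1 m - 1) = (monom 1 (2 * j) - 1 :: complex poly)"
    using chain_poly_telescope[OF j] by blast
  show ?thesis
  proof (cases "e dvd j")
    case True
    note deriv = chain_poly_deriv[OF e j True m(2,1)]
    have "poly (pderiv (chain_poly j)) z \<noteq> 0"
      using deriv(2) j least_neg1_nonzero[OF e] by auto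
    thus ?thesis
      using order_1_if_poly_pderiv_nonzero[OF deriv(1)] True by simp
  next
    case False
    have "poly (chain_poly j) z * (z ^ m - 1) = z ^ (2 * j) - 1"
      using arg_cong[OF m(2), of "\<lambda>p. poly p z"] by (simp add: poly_monom)
    hence "poly (chain_poly j) z \<noteq> 0"
      using least_neg1_power_double_eq_1_iff[OF e, of j] False by auto
    thus ?thesis
      using False by (simp add: order_0I)
  qed
qed

lemma red_den_nonzero: "red_den n \<noteq> (0 :: 'a::idom poly)"
  by (auto simp: red_den_def chain_poly_nonzero)

lemma order_red_den:
  fixes z :: complex
  assumes e: "least_neg1 z e"
  shows "order z (red_den n) = n div e"
proof -
  have "order z (red_den n) = (\<Sum>j=1..n. order z (chain_poly j :: complex poly))"
    unfolding red_den_def by (rule order_prod) (simp add: chain_poly_nonzero)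
  also have "\<dots> = (\<Sum>j=1..n. of_bool (e dvd j))"
    by (rule sum.cong) (simp_all add: order_chain_poly[OF e])
  also have "\<dots> = card {j\<in>{1..n}. e dvd j}"
    by (simp add: Int_def)
  also have "\<dots> = n div e"
    using e by (intro card_multiples) (simp add: least_neg1_def)
  finally show ?thesis .
qed

lemma part_poly_nonzero:
  "\<forall>i\<in>#p. 1 \<le> i \<Longrightarrow> part_poly p \<noteq> (0 :: 'a::idom poly)"
  using xp1_nonzero[where ?'a = 'a] by (fastforce simp: part_poly_def prod_mset_zero_iff)

lemma order_part_poly:
  fixes z :: complex
  assumes "\<forall>i\<in>#p. 1 \<le> i"
  shows "order z (part_poly p) = size {#i \<in># p. z ^ i = -1#}"
  using assms
proof (induction p)
  case empty
  show ?case
    by (simp add: part_poly_def)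
next
  case (add i p)
  have "part_poly (add_mset i p) = (xp1 i * part_poly p :: complex poly)"
    by (simp add: part_poly_def)
  moreover have "xp1 i * part_poly p \<noteq> (0 :: complex poly)"
    using add.prems part_poly_nonzero[of p, where ?'a = complex]
      xp1_nonzero[of i, where ?'a = complex] by simp
  ultimately show ?case
    using add by (simp add: order_mult order_xp1)
qed

lemma filter_mset_replicate:
  "filter_mset P (replicate_mset k x) = (if P x then replicate_mset k x else {#})"
  by (induction k) auto

lemma mult_size_le_sum_mset:
  "\<forall>i\<in>#p. e \<le> i \<Longrightarrow> e * size p \<le> sum_mset (p :: nat multiset)"
  by (induction p) auto

lemma sum_filter_mset_le: "sum_mset (filter_mset P p) \<le> sum_mset (p :: nat multiset)"
  by (induction p) auto

text \<open>A part \<open>i\<close> with \<open>z ^ i = -1\<close> is a positive multiple of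
  \<open>e\<close>, hence at least \<open>e\<close>, so at most \<open>n div e\<close> such parts
  fit into \<open>n\<close>. If no \<open>e\<close> exists, no factor vanishes at
  \<open>z\<close>.\<close>

lemma order_part_poly_le:
  fixes z :: complex
  assumes "p \<in> partitions n"
  shows "order z (part_poly p) \<le> order z (red_den n)"
proof -
  have pos: "\<forall>i\<in>#p. 1 \<le> i" and sum: "sum_mset p = n"
    using assms by (auto simp: partitions_def)
  show ?thesis
  proof (cases "\<exists>e. least_neg1 z e")
    case True
    then obtain e where e: "least_neg1 z e" ..
    have "\<forall>i\<in>#{#i \<in># p. z ^ i = -1#}. e \<le> i"
      using pos power_neg1_least_neg1_dvd[OF e] by (fastforce dest: dvd_imp_le)
    hence "e * size {#i \<in># p. z ^ i = -1#} \<le> n"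
      using mult_size_le_sum_mset sum_filter_mset_le sum order_trans by metis
    thus ?thesis
      using e by (simp add: order_part_poly[OF pos] order_red_den[OF e] least_neg1_def
          less_eq_div_iff_mult_less_eq mult.commute)
  next
    case False
    hence "\<forall>i. i \<notin># {#i \<in># p. z ^ i = -1#}"
      using least_neg1_exists[of _ z] pos by auto
    hence "{#i \<in># p. z ^ i = -1#} = {#}"
      by (metis multiset_nonemptyE)
    hence "order z (part_poly p) = 0"
      by (simp only: order_part_poly[OF pos] size_empty)
    thus ?thesis
      by simp
  qed
qed

text \<open>Sharpness of the bound, which prevents the gcd from exceeding \<open>cofactor\<close>.
  As many parts \<open>e\<close> as possible are taken and filled up with ones; without an
  \<open>e\<close>, \<open>red_den n\<close> has order 0 and any partition serves.\<close>

lemma order_part_poly_attained: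
  fixes z :: complex
  shows "\<exists>p\<in>partitions n. order z (red_den n) \<le> order z (part_poly p)"
proof (cases "\<exists>e. least_neg1 z e")
  case True
  then obtain e where e: "least_neg1 z e" ..
  let ?p = "replicate_mset (n div e) e + replicate_mset (n mod e) 1"
  have e1: "e \<ge> 1" "z ^ e = -1"
    using e by (auto simp: least_neg1_def)
  have p: "?p \<in> partitions n"
    using e1 by (auto simp: partitions_def)
  have "n div e \<le> size {#i \<in># ?p. z ^ i = -1#}"
    using e1 by (simp add: filter_mset_replicate)
  thus ?thesis
    using p by (intro bexI[of _ ?p])
      (auto simp: order_red_den[OF e] order_part_poly partitions_def)
next
  case False
  have "z ^ i \<noteq> -1" if "i \<in> pow2_chain j" "j \<ge> 1" for i j
    using least_neg1_exists[OF pow2_chain_pos[OF that(2,1)]] False by blast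
  hence "poly (red_den n) z \<noteq> 0"
    by (auto simp: red_den_def chain_poly_def poly_prod finite_pow2_chain poly_monom
        add_eq_0_iff)
  moreover have "replicate_mset n 1 \<in> partitions n"
    by (auto simp: partitions_def)
  ultimately show ?thesis
    by (intro bexI[of _ "replicate_mset n 1"]) (auto simp: order_0I)
qed

section \<open>The greatest common divisor\<close>

lemma cpoly_chain_poly: "j \<ge> 1 \<Longrightarrow> cpoly (chain_poly j) = chain_poly j"
  by (simp add: chain_poly_def cpoly_prod)

lemma cpoly_red_den: "cpoly (red_den n) = red_den n"
  by (simp add: red_den_def cpoly_prod cpoly_chain_poly)

lemma cpoly_part_poly: "cpoly (part_poly p) = part_poly p"
  by (induction p) (simp_all add: part_poly_def cpoly_mult)

lemma lead_coeff_cofactor: "lead_coeff (cofactor n :: int poly) = 1"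
  unfolding cofactor_def lead_coeff_prod
  by (intro prod.neutral ballI lead_coeff_xp1) (auto simp: Suc_le_eq intro: dvd_pos_nat)

lemma lead_coeff_h_poly: "lead_coeff (h_poly n p) = 1"
  unfolding h_poly_def lead_coeff_prod lead_coeff_power
  by (intro prod.neutral ballI) (simp add: lead_coeff_xp1 del: coeff_add)

lemma h_poly_nonzero: "h_poly n p \<noteq> 0"
  using lead_coeff_h_poly[of n p] by (metis coeff_0 zero_neq_one)

lemma cofactor_nonzero: "cofactor n \<noteq> (0 :: int poly)"
  using lead_coeff_cofactor[of n] by (metis coeff_0 zero_neq_one)

lemma order_cofactor:
  assumes "p \<in> partitions n"
  shows "order z (red_den n :: complex poly) + order z (cpoly (cofactor n)) =
    order z (cpoly (h_poly n p)) + order z (part_poly p)"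
proof -
  have "\<forall>i\<in>#p. 1 \<le> i"
    using assms by (auto simp: partitions_def)
  hence nz: "cpoly (h_poly n p) * part_poly p \<noteq> 0"
    using part_poly_nonzero[of p, where ?'a = complex] by (simp add: cpoly_eq_0_iff h_poly_nonzero)
  have "red_den n * cofactor n = h_poly n p * part_poly p"
    using h_poly_times_part_poly[OF assms] red_den_times_cofactor[of n] by metis
  hence eq: "red_den n * cpoly (cofactor n) = cpoly (h_poly n p) * part_poly p"
    by (metis cpoly_mult cpoly_red_den cpoly_part_poly)
  have "order z (red_den n * cpoly (cofactor n)) = order z (cpoly (h_poly n p) * part_poly p)"
    by (simp only: eq)
  thus ?thesis
    using nz eq by (metis order_mult)
qed

lemma cofactor_dvd_h_poly:
  assumes "p \<in> partitions n"
  shows "cofactor n dvd h_poly n p"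
proof (rule monic_dvd_if_cpoly_dvd[OF lead_coeff_cofactor], rule complex_dvd_if_order_le)
  show "order z (cpoly (cofactor n)) \<le> order z (cpoly (h_poly n p))" for z
    using order_cofactor[OF assms, of z] order_part_poly_le[OF assms, of z] by linarith
qed (simp_all add: cpoly_eq_0_iff cofactor_nonzero h_poly_nonzero)

lemma degree_0_if_order_0:
  fixes p :: "complex poly"
  assumes "\<And>z. order z p = 0"
  shows "degree p = 0"
proof (cases "p = 0")
  case False
  hence "poly p z \<noteq> 0" for z
    using assms by (simp add: order_root)
  thus ?thesis
    using fundamental_theorem_of_algebra constant_degree by blast
qed simp

text \<open>Write the gcd as \<open>cofactor n * q\<close>. A complex zero of \<open>q\<close> would
  raise the order of every \<open>h_poly n p\<close> there above that of \<open>cofactor n\<close>,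
  against \<open>order_part_poly_attained\<close>. So \<open>q\<close> is constant, and a unit
  because \<open>h_poly\<close> is monic. Associated normalized polynomials are equal.\<close>

lemma G_poly_eq_cofactor: "G_poly n = cofactor n"
proof -
  have "cofactor n dvd G_poly n"
    unfolding G_poly_def by (rule Gcd_greatest) (auto intro: cofactor_dvd_h_poly)
  then obtain q where q: "G_poly n = cofactor n * q" ..
  have G_dvd: "G_poly n dvd h_poly n p" if "p \<in> partitions n" for p
    unfolding G_poly_def using that by (intro Gcd_dvd) auto
  have ex: "replicate_mset n 1 \<in> partitions n"
    by (auto simp: partitions_def)
  then obtain r where r: "h_poly n (replicate_mset n 1) = G_poly n * r"
    using G_dvd by (auto elim: dvdE)
  have "lead_coeff q * lead_coeff r = 1"
    using lead_coeff_h_poly[of n "replicate_mset n 1"] lead_coeff_cofactor[of n]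
    unfolding r q lead_coeff_mult by simp
  hence unit: "is_unit (lead_coeff q)"
    by (metis dvd_triv_left)
  have q0: "q \<noteq> 0"
    using unit by auto
  have "order z (cpoly q) = 0" for z
  proof -
    \<comment> \<open>The partition depends on \<open>z\<close>; no single one has to work for all
      zeros.\<close>
    obtain p where p: "p \<in> partitions n" "order z (red_den n) \<le> order z (part_poly p)"
      using order_part_poly_attained by blast
    have "cpoly (cofactor n) * cpoly q dvd cpoly (h_poly n p)"
      using G_dvd[OF p(1)] unfolding q by (auto simp: cpoly_mult elim!: dvdE)
    hence "order z (cpoly (cofactor n) * cpoly q) \<le> order z (cpoly (h_poly n p))"
      by (intro dvd_imp_order_le) (simp_all add: cpoly_eq_0_iff h_poly_nonzero)
    hence "order z (cpoly (cofactor n)) + order z (cpoly q) \<le> order z (cpoly (h_poly n p))"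
      by (simp add: order_mult cpoly_eq_0_iff cofactor_nonzero q0)
    thus ?thesis
      using order_cofactor[OF p(1), of z] p(2) by linarith
  qed
  hence "degree q = 0"
    using degree_0_if_order_0 degree_cpoly by metis
  hence "is_unit q"
    using unit by (auto simp: is_unit_poly_iff elim!: degree_eq_zeroE)
  hence "G_poly n dvd cofactor n"
    unfolding q by (simp add: mult_unit_dvd_iff)
  moreover have "normalize (G_poly n) = G_poly n"
    by (simp add: G_poly_def)
  moreover have "normalize (cofactor n) = (cofactor n :: int poly)"
    using lead_coeff_cofactor[of n] by (simp add: normalize_poly_eq_map_poly map_poly_id')
  ultimately show ?thesis
    using \<open>cofactor n dvd G_poly n\<close> by (metis associated_eqI)
qed

section \<open>Values of the numerator\<close>

text \<open>The contribution of one partition to the reduced numerator. The division is done over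
  the integers, where it is exact for partitions of \<open>n\<close>, before passing to complex
  coefficients.\<close>

definition summand :: "nat \<Rightarrow> nat multiset \<Rightarrow> complex poly" where
  "summand n p = cpoly (h_poly n p div cofactor n)"

lemma summand_times_part_poly:
  assumes "p \<in> partitions n"
  shows "summand n p * part_poly p = red_den n"
proof -
  have "cofactor n * ((h_poly n p div cofactor n) * part_poly p) = cofactor n * red_den n"
    using h_poly_times_part_poly[OF assms] red_den_times_cofactor[of n, where ?'a = int]
      cofactor_dvd_h_poly[OF assms]
    by (simp flip: mult.assoc) (simp add: mult.commute)
  hence "(h_poly n p div cofactor n) * part_poly p = red_den n"
    using cofactor_nonzero by simp
  thus ?thesis
    unfolding summand_def by (metis cpoly_mult cpoly_red_den cpoly_part_poly)
qed

lemma num_at_eq_sum: "num_at n z = (\<Sum>p\<in>partitions n. poly (summand n p) z)"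
proof -
  have "num_star n = (\<Sum>p\<in>partitions n. cofactor n * (h_poly n p div cofactor n))"
    unfolding num_star_def using cofactor_dvd_h_poly by (intro sum.cong) simp_all
  hence "num_poly n = (\<Sum>p\<in>partitions n. h_poly n p div cofactor n)"
    unfolding num_poly_def G_poly_eq_cofactor using cofactor_nonzero
    by (simp flip: sum_distrib_left)
  thus ?thesis
    by (simp add: num_at_def cpoly_sum poly_sum summand_def)
qed

text \<open>Every element other than \<open>e\<close> costs at least one additional
  \<open>e\<close>. With \<open>n div e\<close> elements and total at most \<open>n\<close>, there
  is no room for this.\<close>

lemma multiples_sum_bound:
  fixes F :: "nat multiset"
  assumes "\<forall>i\<in>#F. i = e \<or> 2 * e \<le> i"
  shows "e * size F + e * size {#i \<in># F. i \<noteq> e#} \<le> sum_mset F"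
  using assms by (induction F) auto

text \<open>If the summand has order 0 at \<open>z\<close>, all \<open>n div e\<close> zeros of
  \<open>red_den n\<close> come from \<open>part_poly p\<close>. So exactly \<open>n div e\<close>
  parts are multiples of \<open>e\<close>, and the size of \<open>n\<close> forces each to equal
  \<open>e\<close>.\<close>

lemma summand_nonzero_imp:
  assumes e: "least_neg1 z e" and p: "p \<in> partitions n" and nz: "poly (summand n p) z \<noteq> 0"
  shows "\<exists>q\<in>partitions (n mod e). p = replicate_mset (n div e) e + q"
proof -
  have pos: "\<forall>i\<in>#p. 1 \<le> i" and sum: "sum_mset p = n"
    using p by (auto simp: partitions_def)
  have e1: "e \<ge> 1"
    using e by (simp add: least_neg1_def)
  define F where "F = {#i \<in># p. z ^ i = -1#}"
  define q where "q = {#i \<in># p. z ^ i \<noteq> -1#}"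
  have pFq: "p = F + q"
    unfolding F_def q_def by (rule multiset_partition)
  have "order z (summand n p * part_poly p) = order z (summand n p) + order z (part_poly p)"
    using red_den_nonzero[of n, where ?'a = complex]
    by (intro order_mult) (simp add: summand_times_part_poly[OF p])
  hence size: "size F = n div e"
    using nz by (simp add: summand_times_part_poly[OF p] order_red_den[OF e] order_0I
        order_part_poly[OF pos] F_def)
  have "\<forall>i\<in>#F. i = e \<or> 2 * e \<le> i"
  proof
    fix i assume i: "i \<in># F"
    hence "e dvd i"
      using power_neg1_least_neg1_dvd[OF e] by (auto simp: F_def)
    then obtain k where k: "i = e * k" ..
    moreover have "1 \<le> i"
      using i pos by (auto simp: F_def)
    ultimately show "i = e \<or> 2 * e \<le> i"
      by (cases k; cases "k - 1") auto
  qed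
  hence "e * size F + e * size {#i \<in># F. i \<noteq> e#} \<le> n"
    using multiples_sum_bound[of F e] sum pFq by simp
  hence "e * size {#i \<in># F. i \<noteq> e#} \<le> n mod e"
    using size by (metis add_le_cancel_left mult_div_mod_eq)
  also have "n mod e < e * 1"
    using e1 by simp
  finally have "size {#i \<in># F. i \<noteq> e#} = 0"
    by (metis mult_less_cancel1 less_one)
  hence "{i. i \<in># F \<and> i \<noteq> e} = {}"
    by (metis set_mset_filter set_mset_empty size_eq_0_iff_empty)
  hence "\<forall>i\<in>#F. i = e"
    by blast
  hence F: "F = replicate_mset (n div e) e"
    using size set_mset_subset_singletonD[of F e] by auto
  have "sum_mset q = n mod e"
    using sum unfolding pFq F by (simp add: minus_div_mult_eq_mod[symmetric])
  moreover have "\<forall>i\<in>#q. 1 \<le> i"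
    using pos pFq by simp
  ultimately show ?thesis
    using pFq F by (intro bexI[of _ q]) (auto simp: partitions_def)
qed

text \<open>By the product rule, dividing out \<open>x - z\<close> replaces the value at
  \<open>z\<close> by that of the derivative.\<close>

lemma poly_eq_pderiv_cofactor:
  fixes p :: "complex poly"
  assumes "poly p z = 0"
  shows "\<exists>q. p = [:-z, 1:] * q \<and> poly q z = poly (pderiv p) z"
proof -
  obtain q where "p = [:-z, 1:] * q"
    using assms by (metis poly_eq_0_iff_dvd dvdE)
  moreover have "poly (pderiv ([:-z, 1:] * q)) z = poly q z"
    unfolding pderiv_mult by (simp add: pderiv_pCons)
  ultimately show ?thesis
    by auto
qed

text \<open>For \<open>least_neg1 z e\<close> and \<open>j \<ge> 1\<close>, the value of
  \<open>chain_poly j\<close> at \<open>z\<close> once its simple zero there, if any, is divided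
  out.\<close>

definition chain_val :: "complex \<Rightarrow> nat \<Rightarrow> nat \<Rightarrow> complex" where
  "chain_val z e j = (if e dvd j then poly (pderiv (chain_poly j)) z else poly (chain_poly j) z)"

lemma red_den_factor:
  assumes e: "least_neg1 z e"
  shows "\<exists>K. red_den n = [:-z, 1:] ^ (n div e) * K \<and> poly K z = (\<Prod>j=1..n. chain_val z e j)"
proof -
  have "\<exists>k. chain_poly j = [:-z, 1:] ^ of_bool (e dvd j) * k \<and> poly k z = chain_val z e j"
    if j: "j \<ge> 1" for j
  proof (cases "e dvd j")
    case True
    obtain m k where m: "odd m"
      "chain_poly j * (monom 1 m - 1) = (monom 1 (2 * j) - 1 :: complex poly)"
      using chain_poly_telescope[OF j] by blast
    show ?thesis
      using poly_eq_pderiv_cofactor[OF chain_poly_deriv(1)[OF e j True m(2,1)]] True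
      by (simp add: chain_val_def)
  qed (simp add: chain_val_def)
  then obtain k where k: "\<And>j. j \<ge> 1 \<Longrightarrow> chain_poly j = [:-z, 1:] ^ of_bool (e dvd j) * k j"
      "\<And>j. j \<ge> 1 \<Longrightarrow> poly (k j) z = chain_val z e j"
    by metis
  have "red_den n = (\<Prod>j=1..n. [:-z, 1:] ^ of_bool (e dvd j) * k j)"
    unfolding red_den_def by (rule prod.cong) (simp_all add: k(1))
  also have "\<dots> = [:-z, 1:] ^ (\<Sum>j=1..n. of_bool (e dvd j)) * (\<Prod>j=1..n. k j)"
    by (simp only: prod.distrib power_sum)
  also have "(\<Sum>j=1..n. of_bool (e dvd j)) = card {j\<in>{1..n}. e dvd j}"
    by (simp add: Int_def)
  also have "\<dots> = n div e"
    using e by (intro card_multiples) (simp add: least_neg1_def)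
  finally show ?thesis
    using k(2) by (intro exI[of _ "\<Prod>j=1..n. k j"]) (simp add: poly_prod)
qed

lemma part_poly_add: "part_poly (p + q) = part_poly p * part_poly q"
  by (simp add: part_poly_def)

text \<open>Both \<open>red_den n\<close> and the product over the parts \<open>e\<close> contain
  the factor \<open>x - z\<close> to the power \<open>n div e\<close>. After cancelling it, each
  part \<open>e\<close> leaves the derivative \<open>e * z ^ (e - 1)\<close> of
  \<open>xp1 e\<close>.\<close>

lemma summand_value:
  assumes e: "least_neg1 z e" and q: "q \<in> partitions (n mod e)"
  shows "replicate_mset (n div e) e + q \<in> partitions n" (is "?p \<in> _")
    and "poly (summand n (replicate_mset (n div e) e + q)) z * (of_nat e * z ^ (e - 1)) ^ (n div e) =
      (\<Prod>j=1..n. chain_val z e j) * (1 / poly (part_poly q) z)"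
proof -
  have e1: "e \<ge> 1" "z ^ e = -1"
    using e by (auto simp: least_neg1_def)
  show p: "?p \<in> partitions n"
    using q e1 by (auto simp: partitions_def)
  \<comment> \<open>By minimality of \<open>e\<close>, parts below \<open>e\<close> give
    nonvanishing factors, so division by \<open>part_poly q\<close> at \<open>z\<close> is
    legitimate.\<close>
  have qpos: "1 \<le> i" "i < e" if "i \<in># q" for i
  proof -
    show "1 \<le> i"
      using q that by (auto simp: partitions_def)
    have "i \<le> n mod e"
      using q that by (auto simp: partitions_def dest!: multi_member_split)
    also have "\<dots> < e"
      using e1 by simp
    finally show "i < e" .
  qed
  have "poly (part_poly q) z = (\<Prod>i\<in>#q. 1 + z ^ i)"
    by (induction q) (simp_all add: part_poly_def poly_monom)
  also have "\<dots> \<noteq> 0"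
    using qpos e by (fastforce simp: prod_mset_zero_iff least_neg1_def add_eq_0_iff)
  finally have nz: "poly (part_poly q) z \<noteq> 0" .
  obtain K where K: "red_den n = [:-z, 1:] ^ (n div e) * K"
      "poly K z = (\<Prod>j=1..n. chain_val z e j)"
    using red_den_factor[OF e] by blast
  have "poly (xp1 e) z = 0"
    using e1 by (simp add: poly_monom)
  then obtain E where E: "xp1 e = [:-z, 1:] * E" "poly E z = poly (pderiv (xp1 e)) z"
    using poly_eq_pderiv_cofactor by blast
  have Ez: "poly E z = of_nat e * z ^ (e - 1)"
    unfolding E(2) by (simp add: pderiv_add pderiv_monom poly_monom)
  have "part_poly (replicate_mset (n div e) e) = (xp1 e :: complex poly) ^ (n div e)"
    by (simp add: part_poly_def)
  hence "summand n ?p * (([:-z, 1:] * E) ^ (n div e) * part_poly q) = [:-z, 1:] ^ (n div e) * K"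
    using summand_times_part_poly[OF p] by (simp only: part_poly_add E(1) K(1))
  hence "[:-z, 1:] ^ (n div e) * (summand n ?p * E ^ (n div e) * part_poly q) =
      [:-z, 1:] ^ (n div e) * K"
    by (simp only: power_mult_distrib mult_ac)
  moreover have "[:-z, 1:] ^ (n div e) \<noteq> 0"
    by simp
  ultimately have "summand n ?p * E ^ (n div e) * part_poly q = K"
    by (metis mult_left_cancel)
  hence "poly (summand n ?p * E ^ (n div e) * part_poly q) z = poly K z"
    by simp
  thus "poly (summand n ?p) z * (of_nat e * z ^ (e - 1)) ^ (n div e) =
      (\<Prod>j=1..n. chain_val z e j) * (1 / poly (part_poly q) z)"
    using nz by (simp add: K(2) Ez field_simps)
qed

text \<open>Only partitions extending one of \<open>n mod e\<close> by parts \<open>e\<close>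
  contribute, and the factors coming from these parts are the same for all of them.\<close>

lemma num_at_formula:
  assumes e: "least_neg1 z e"
  shows "num_at n z * (of_nat e * z ^ (e - 1)) ^ (n div e) =
    (\<Prod>j=1..n. chain_val z e j) * (\<Sum>q\<in>partitions (n mod e). 1 / poly (part_poly q) z)"
proof -
  let ?f = "\<lambda>q. replicate_mset (n div e) e + q"
  have "num_at n z = (\<Sum>p\<in>?f ` partitions (n mod e). poly (summand n p) z)"
    unfolding num_at_eq_sum
  proof (rule sum.mono_neutral_right[OF finite_partitions])
    show "?f ` partitions (n mod e) \<subseteq> partitions n"
      using summand_value(1)[OF e] by auto
    show "\<forall>p\<in>partitions n - ?f ` partitions (n mod e). poly (summand n p) z = 0"
      using summand_nonzero_imp[OF e] by blast
  qed
  also have "\<dots> = (\<Sum>q\<in>partitions (n mod e). poly (summand n (?f q)) z)"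
    by (subst sum.reindex) (auto simp: inj_on_def)
  finally show ?thesis
    by (simp only: sum_distrib_right sum_distrib_left)
      (intro sum.cong refl, simp only: summand_value(2)[OF e])
qed

section \<open>Evaluation at the three roots of unity\<close>

lemma chain_val_dvd:
  assumes "least_neg1 z e" "j \<ge> 1" "e dvd j"
  shows "\<exists>m k. odd m \<and> j = m * 2 ^ k \<and>
    chain_val z e j * (z ^ m - 1) = 2 * of_nat j * z ^ (2 * j - 1)"
proof -
  obtain m k where m: "odd m" "j = m * 2 ^ k"
    "chain_poly j * (monom 1 m - 1) = (monom 1 (2 * j) - 1 :: complex poly)"
    using chain_poly_telescope[OF assms(2)] by blast
  thus ?thesis
    using chain_poly_deriv(2)[OF assms m(3,1)] assms(3) unfolding chain_val_def by auto
qed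

lemma chain_val_not_dvd:
  assumes "j \<ge> 1" "\<not> e dvd j"
  shows "\<exists>m k. odd m \<and> j = m * 2 ^ k \<and> chain_val z e j * (z ^ m - 1) = z ^ (2 * j) - 1"
proof -
  obtain m k where m: "odd m" "j = m * 2 ^ k"
    "chain_poly j * (monom 1 m - 1) = (monom 1 (2 * j) - 1 :: complex poly)"
    using chain_poly_telescope[OF assms(1)] by blast
  have "poly (chain_poly j) z * (z ^ m - 1) = z ^ (2 * j) - 1"
    using arg_cong[OF m(3), of "\<lambda>p. poly p z"] by (simp add: poly_monom)
  thus ?thesis
    using m(1,2) assms(2) unfolding chain_val_def by auto
qed

text \<open>For \<open>e = 2\<close> and \<open>e = 3\<close> the absolute values of
  \<open>chain_val\<close> have this shape.\<close>

lemma prod_multiples: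
  fixes a b :: real
  assumes "e \<ge> 1"
  shows "(\<Prod>j=1..n. if e dvd j then a * of_nat j else b) =
    (a * of_nat e) ^ (n div e) * fact (n div e) * b ^ (n - n div e)"
proof -
  have "(\<Prod>j=1..n. if e dvd j then a * of_nat j else b) =
      (\<Prod>j\<in>{j\<in>{1..n}. e dvd j}. a * of_nat j) * (\<Prod>j\<in>{1..n} - {j\<in>{1..n}. e dvd j}. b)"
    by (subst prod.If_cases) (auto intro!: arg_cong2[of _ _ _ _ "(*)"] prod.cong
        arg_cong[of _ _ "\<lambda>A. b ^ card A"])
  also have "(\<Prod>j\<in>{j\<in>{1..n}. e dvd j}. a * of_nat j) = (\<Prod>k=1..n div e. a * of_nat e * of_nat k)"
    unfolding multiples_eq_image[OF assms]
    using assms by (subst prod.reindex) (auto simp: inj_on_def mult.assoc)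
  also have "\<dots> = (a * of_nat e) ^ (n div e) * fact (n div e)"
    unfolding prod.distrib by (simp add: fact_prod power_mult_distrib)
  also have "(\<Prod>j\<in>{1..n} - {j\<in>{1..n}. e dvd j}. b) = b ^ (n - n div e)"
  proof -
    have "card ({1..n} - {j\<in>{1..n}. e dvd j}) = n - n div e"
      by (subst card_Diff_subset) (auto simp only: card_multiples[OF assms] card_atLeastAtMost, auto)
    thus ?thesis
      by (simp only: prod_constant)
  qed
  finally show ?thesis .
qed

section \<open>Partitions of the possible remainders 0, 1 and 2\<close>

lemma partitions_0: "partitions 0 = {{#}}"
proof -
  have "p = {#}" if "p \<in> partitions 0" for p
    using that by (cases p) (auto simp: partitions_def)
  thus ?thesis
    by (auto simp: partitions_def)
qed

lemma partitions_Suc_cases: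
  assumes "p \<in> partitions (Suc n)"
  obtains i q where "p = add_mset i q" "1 \<le> i" "i \<le> Suc n" "q \<in> partitions (Suc n - i)"
  using assms by (cases p) (auto simp: partitions_def)

lemma partitions_1: "partitions 1 = {{#1#}}"
proof (intro equalityI subsetI)
  fix p assume "p \<in> partitions 1"
  then obtain i q where "p = add_mset i q" "1 \<le> i" "i \<le> 1" "q \<in> partitions (1 - i)"
    by (metis partitions_Suc_cases One_nat_def)
  moreover from this have "i = 1"
    by simp
  ultimately show "p \<in> {{#1#}}"
    by (simp add: partitions_0)
qed (simp add: partitions_def)

lemma partitions_2: "partitions 2 = {{#1, 1#}, {#2#}}"
proof (intro equalityI subsetI)
  fix p assume "p \<in> partitions 2"
  then obtain i q where "p = add_mset i q" "1 \<le> i" "i \<le> 2" "q \<in> partitions (2 - i)"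
    by (metis partitions_Suc_cases Suc_1)
  note p = this
  from p(2,3) consider "i = 1" | "i = 2"
    by linarith
  thus "p \<in> {{#1, 1#}, {#2#}}"
  proof cases
    case 1
    hence "q \<in> partitions 1"
      using p(4) by simp
    thus ?thesis
      unfolding partitions_1 using p(1) 1 by simp
  next
    case 2
    thus ?thesis
      using p(1,4) by (simp add: partitions_0)
  qed
qed (auto simp: partitions_def)

section \<open>The value at -1\<close>

lemma num_at_neg1: "num_at n (-1) = fact n"
proof -
  have e: "least_neg1 (-1) 1"
    by (simp add: least_neg1_def)
  \<comment> \<open>Here \<open>z ^ m - 1 = -2\<close> and \<open>z ^ (2 * j - 1) = -1\<close>,
    since both exponents are odd.\<close>
  have "chain_val (-1) 1 j = of_nat j" if "j \<in> {1..n}" for j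
    using chain_val_dvd[OF e, of j] that by auto
  hence "(\<Prod>j=1..n. chain_val (-1) 1 j) = fact n"
    by (simp add: fact_prod)
  thus ?thesis
    using num_at_formula[OF e, of n] by (simp add: partitions_0 part_poly_def)
qed

lemma least_neg1_norm:
  assumes "least_neg1 z e"
  shows "cmod z = 1"
proof -
  have "cmod z ^ e = 1" "e \<ge> 1"
    using assms by (simp_all add: least_neg1_def flip: norm_power)
  thus ?thesis
    using power_eq_1_iff[of "cmod z" e] by auto
qed

text \<open>Powers of \<open>z\<close> have absolute value 1, and the factor
  \<open>e ^ (n div e)\<close> on the left of \<open>num_at_formula\<close> cancels against the one
  from \<open>prod_multiples\<close>.\<close>

lemma norm_num_at_formula:
  assumes e: "least_neg1 z e"
    and multiple: "\<And>j. j \<ge> 1 \<Longrightarrow> e dvd j \<Longrightarrow> cmod (chain_val z e j) = a * of_nat j"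
    and nonmultiple: "\<And>j. j \<ge> 1 \<Longrightarrow> \<not> e dvd j \<Longrightarrow> cmod (chain_val z e j) = b"
  shows "cmod (num_at n z) = a ^ (n div e) * fact (n div e) * b ^ (n - n div e) *
    cmod (\<Sum>q\<in>partitions (n mod e). 1 / poly (part_poly q) z)"
proof -
  have e1: "e \<ge> 1"
    using e by (simp add: least_neg1_def)
  have "cmod (\<Prod>j=1..n. chain_val z e j) = (\<Prod>j=1..n. if e dvd j then a * of_nat j else b)"
    unfolding prod_norm[symmetric] by (rule prod.cong) (use multiple nonmultiple in auto)
  also have "\<dots> = (a * of_nat e) ^ (n div e) * fact (n div e) * b ^ (n - n div e)"
    by (rule prod_multiples[OF e1])
  finally have "cmod (num_at n z) * of_nat e ^ (n div e) =
      (a * of_nat e) ^ (n div e) * fact (n div e) * b ^ (n - n div e) *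
      cmod (\<Sum>q\<in>partitions (n mod e). 1 / poly (part_poly q) z)"
    using arg_cong[OF num_at_formula[OF e, of n], of cmod]
    by (simp add: norm_mult norm_power least_neg1_norm[OF e])
  thus ?thesis
    using e1 by (simp add: power_mult_distrib)
qed

section \<open>Absolute values at the primitive fourth roots of unity\<close>

lemma square_root_of_neg1:
  fixes w :: complex
  assumes "w ^ 2 = -1"
  shows "cmod (w - 1) = sqrt 2" "cmod (1 + w) = sqrt 2"
proof -
  have "w = \<i> \<or> w = -\<i>"
    using assms power2_eq_iff[of w \<i>] by simp
  thus "cmod (w - 1) = sqrt 2" "cmod (1 + w) = sqrt 2"
    by (auto simp: cmod_def)
qed

lemma norm_num_at_i:
  assumes "z ^ 2 = -1"
  shows "cmod (num_at n z) = 2 ^ (n div 2) * fact (n div 2)"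
proof -
  have e: "least_neg1 z 2"
    using assms by (auto simp: least_neg1_def numeral_2_eq_2 less_Suc_eq)
  have odd_power: "(z ^ m) ^ 2 = -1" if "odd m" for m
    using assms that by (simp add: power_mult[symmetric] mult.commute[of m]) (simp add: power_mult)
  have even: "cmod (chain_val z 2 j) = sqrt 2 * of_nat j" if j: "j \<ge> 1" "2 dvd j" for j
  proof -
    obtain m where m: "odd m" "chain_val z 2 j * (z ^ m - 1) = 2 * of_nat j * z ^ (2 * j - 1)"
      using chain_val_dvd[OF e j] by blast
    have "cmod (chain_val z 2 j) * sqrt 2 = (sqrt 2 * of_nat j) * sqrt 2"
      using arg_cong[OF m(2), of cmod] square_root_of_neg1(1)[OF odd_power[OF m(1)]]
      by (simp add: norm_mult norm_power least_neg1_norm[OF e])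
    thus ?thesis
      by simp
  qed
  \<comment> \<open>For odd \<open>j\<close> the chain consists of the single factor
    \<open>1 + z ^ j\<close>.\<close>
  have odd: "cmod (chain_val z 2 j) = sqrt 2" if "j \<ge> 1" "\<not> 2 dvd j" for j
    using square_root_of_neg1(2)[OF odd_power[OF that(2)]] that(2)
    by (simp add: chain_val_def chain_poly_odd poly_monom)
  have n: "n div 2 + (n - n div 2) = 2 * (n div 2) + n mod 2"
    by simp
  have "cmod (num_at n z) = sqrt 2 ^ (n div 2) * fact (n div 2) * sqrt 2 ^ (n - n div 2) *
      cmod (\<Sum>q\<in>partitions (n mod 2). 1 / poly (part_poly q) z)"
    by (rule norm_num_at_formula[OF e even odd])
  also have "\<dots> = sqrt 2 ^ (n div 2 + (n - n div 2)) * fact (n div 2) *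
      cmod (\<Sum>q\<in>partitions (n mod 2). 1 / poly (part_poly q) z)"
    by (simp only: power_add mult_ac)
  also have "\<dots> = 2 ^ (n div 2) * fact (n div 2) *
      (sqrt 2 ^ (n mod 2) * cmod (\<Sum>q\<in>partitions (n mod 2). 1 / poly (part_poly q) z))"
  proof -
    have "sqrt 2 ^ (n div 2 + (n - n div 2)) = 2 ^ (n div 2) * sqrt 2 ^ (n mod 2)"
      unfolding n power_add power_mult by simp
    thus ?thesis
      by (simp only: mult_ac)
  qed
  \<comment> \<open>For odd \<open>n\<close> the surplus \<open>sqrt 2\<close> cancels against
    \<open>1 / (1 + z)\<close> from the only partition of 1.\<close>
  also have "sqrt 2 ^ (n mod 2) * cmod (\<Sum>q\<in>partitions (n mod 2). 1 / poly (part_poly q) z) = 1"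
  proof (cases "even n")
    case True
    thus ?thesis
      by (simp add: even_iff_mod_2_eq_zero partitions_0 part_poly_def)
  next
    case False
    hence "n mod 2 = 1"
      by presburger
    moreover have "cmod (1 + z) = sqrt 2"
      using square_root_of_neg1(2)[OF assms] .
    ultimately show ?thesis
      using partitions_1 by (simp add: part_poly_def poly_monom norm_divide)
  qed
  finally show ?thesis
    by simp
qed

section \<open>Absolute values at the primitive sixth roots of unity\<close>

lemma cube_root_of_neg1:
  fixes w :: complex
  assumes "w ^ 3 = -1" "w \<noteq> -1"
  shows "w ^ 2 = w - 1"
proof -
  have "(w + 1) * (w ^ 2 - (w - 1)) = w ^ 3 + 1"
    by (simp add: algebra_simps power2_eq_square power3_eq_cube)
  thus ?thesis
    using assms by (simp add: add_eq_0_iff2)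
qed

lemma norm_cube_root_of_1_minus_1:
  fixes u :: complex
  assumes "u ^ 3 = 1" "u \<noteq> 1"
  shows "cmod (u - 1) = sqrt 3"
proof -
  have "(u - 1) * (u ^ 2 + u + 1) = u ^ 3 - 1"
    by (simp add: algebra_simps power2_eq_square power3_eq_cube)
  hence "u ^ 2 + u + 1 = 0"
    using assms by simp
  hence "(u - 1) ^ 2 = -3 * u"
    by (simp add: power2_diff) algebra
  moreover have "cmod u = 1"
    using assms(1) power_eq_1_iff[of u 3] by simp
  ultimately have "cmod (u - 1) ^ 2 = 3"
    by (simp add: norm_mult flip: norm_power)
  thus ?thesis
    by (metis norm_ge_zero real_sqrt_unique)
qed

lemma norm_num_at_sixth_root:
  assumes z: "primitive_root_of_unity 6 z"
  shows "cmod (num_at n z) = (if n mod 3 \<noteq> 2 then 3 ^ (n div 3) * fact (n div 3)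
    else 4 * 3 ^ (n div 3) * fact (n div 3))"
proof -
  have z6: "z ^ 6 = 1" and zk: "\<And>k. 0 < k \<Longrightarrow> k < 6 \<Longrightarrow> z ^ k \<noteq> 1"
    using z by (auto simp: primitive_root_of_unity_def)
  have "(z ^ 3) ^ 2 = 1"
    using z6 by (simp flip: power_mult)
  hence "z ^ 3 = 1 \<or> z ^ 3 = -1"
    by (simp only: power2_eq_1_iff)
  hence z3: "z ^ 3 = -1"
    using zk[of 3] by auto
  have z1: "z \<noteq> -1"
    using zk[of 2] by auto
  have z2: "z ^ 2 = z - 1"
    using z3 z1 by (rule cube_root_of_neg1)
  have "z ^ 2 \<noteq> -1"
    using z2 zk[of 1] by (auto simp: power2_eq_square)
  hence e: "least_neg1 z 3"
    using z1 z3 by (auto simp: least_neg1_def numeral_3_eq_3 less_Suc_eq numeral_2_eq_2)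
  have nz: "cmod z = 1"
    using e by (rule least_neg1_norm)
  \<comment> \<open>The odd part \<open>m\<close> of \<open>j\<close> is again divisible by 3, so
    \<open>z ^ m - 1 = -2\<close> cancels the factor 2.\<close>
  have multiple: "cmod (chain_val z 3 j) = 1 * of_nat j" if j: "j \<ge> 1" "3 dvd j" for j
  proof -
    obtain m k where m: "odd m" "j = m * 2 ^ k"
      "chain_val z 3 j * (z ^ m - 1) = 2 * of_nat j * z ^ (2 * j - 1)"
      using chain_val_dvd[OF e j] by blast
    have "coprime 3 (2 ^ k :: nat)"
      by (simp add: coprime_power_right_iff)
    hence "3 dvd m"
      using j(2) m(2) by (simp add: coprime_dvd_mult_left_iff)
    then obtain t where t: "m = 3 * t" ..
    hence "z ^ m = -1"
      using m(1) by (simp add: power_mult z3)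
    thus ?thesis
      using arg_cong[OF m(3), of cmod] by (simp add: norm_mult norm_power nz)
  qed
  \<comment> \<open>The denominator \<open>z ^ m - 1\<close> equals \<open>(z ^ m) ^ 2\<close> and
    has absolute value 1. In the numerator, \<open>z ^ (2 * j)\<close> is a cube root of unity other
    than 1.\<close>
  have nonmultiple: "cmod (chain_val z 3 j) = sqrt 3" if j: "j \<ge> 1" "\<not> 3 dvd j" for j
  proof -
    obtain m k where m: "odd m" "j = m * 2 ^ k"
      "chain_val z 3 j * (z ^ m - 1) = z ^ (2 * j) - 1"
      using chain_val_not_dvd[OF j] by blast
    have "\<not> 3 dvd m"
      using j(2) m(2) by auto
    hence "z ^ m \<noteq> -1"
      using power_neg1_least_neg1_dvd[OF e] by blast
    moreover have "(z ^ m) ^ 3 = -1"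
      using m(1) by (simp add: power_mult[symmetric] mult.commute[of m]) (simp add: power_mult z3)
    ultimately have "z ^ m - 1 = (z ^ m) ^ 2"
      using cube_root_of_neg1 by simp
    hence "cmod (z ^ m - 1) = 1"
      by (simp add: norm_power nz)
    moreover have "(z ^ (2 * j)) ^ 3 = (z ^ 6) ^ j"
      by (simp flip: power_mult add: mult.commute)
    hence "cmod (z ^ (2 * j) - 1) = sqrt 3"
      using z6 least_neg1_power_double_eq_1_iff[OF e, of j] j(2)
      by (intro norm_cube_root_of_1_minus_1) auto
    ultimately show ?thesis
      using arg_cong[OF m(3), of cmod] by (simp add: norm_mult)
  qed
  \<comment> \<open>The leftover factor \<open>sqrt 3 ^ (n mod 3) * S\<close> is the source of the
    case distinction: it is 1, 1 and 4 for remainders 0, 1 and 2.\<close>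
  define S where "S = cmod (\<Sum>q\<in>partitions (n mod 3). 1 / poly (part_poly q) z)"
  have n: "n - n div 3 = 2 * (n div 3) + n mod 3"
    by presburger
  have num: "cmod (num_at n z) = 3 ^ (n div 3) * fact (n div 3) * (sqrt 3 ^ (n mod 3) * S)"
    using norm_num_at_formula[OF e multiple nonmultiple, of n]
    unfolding n S_def by (simp add: power_add power_mult)
  have sq: "(1 + z) ^ 2 = 3 * z"
    by (simp add: power2_sum z2)
  have "n mod 3 = 0 \<or> n mod 3 = 1 \<or> n mod 3 = 2"
    by presburger
  thus ?thesis
  proof (elim disjE)
    assume r: "n mod 3 = 0"
    have "S = 1"
      by (simp add: S_def r partitions_0 part_poly_def)
    thus ?thesis
      using num r by simp
  next
    assume r: "n mod 3 = 1"
    have "cmod (1 + z) ^ 2 = 3"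
      using sq nz by (simp add: norm_mult flip: norm_power)
    hence "cmod (1 + z) = sqrt 3"
      by (metis norm_ge_zero real_sqrt_unique)
    hence "S = 1 / sqrt 3"
      using partitions_1 by (simp add: S_def r part_poly_def poly_monom norm_divide)
    thus ?thesis
      using num r by simp
  next
    assume r: "n mod 3 = 2"
    have ne: "{#1, 1#} \<noteq> {#2 :: nat#}"
      by auto
    have "(\<Sum>q\<in>partitions 2. 1 / poly (part_poly q) z) = 1 / (1 + z) ^ 2 + 1 / (1 + z ^ 2)"
      using ne by (simp add: partitions_2 part_poly_def poly_monom power2_eq_square)
    \<comment> \<open>Since \<open>1 + z ^ 2 = z\<close>, the two partitions of 2 give
      \<open>1 / (3 * z)\<close> and \<open>1 / z\<close>.\<close>
    also have "\<dots> = 4 / (3 * z)"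
      unfolding sq z2 using nz by (auto simp: field_simps)
    finally have "S = 4 / 3"
      using nz by (simp add: S_def r norm_divide norm_mult)
    thus ?thesis
      using num r by simp
  qed
qed

theorem theorem3p21:
  fixes n :: nat
  assumes "n \<ge> 1"
  shows "poly (num_poly n) (-1) = fact n
    \<and> cmod (num_at n \<i>) = 2 ^ (n div 2) * fact (n div 2)
    \<and> cmod (num_at n (- \<i>)) = 2 ^ (n div 2) * fact (n div 2)
    \<and> (\<forall>\<zeta>. primitive_root_of_unity 6 \<zeta> \<longrightarrow>
         cmod (num_at n \<zeta>) =
           (if n mod 3 \<noteq> 2 then 3 ^ (n div 3) * fact (n div 3)
            else 4 * 3 ^ (n div 3) * fact (n div 3)))"
proof -
  \<comment> \<open>The first claim is an identity of integers, so the complex evaluation is pulled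
    back along the injective \<open>of_int\<close>.\<close>
  have "complex_of_int (poly (num_poly n) (-1)) = of_int (fact n)"
    using num_at_neg1[of n] poly_cpoly_of_int[of "num_poly n" "-1"] by (simp add: num_at_def)
  hence "poly (num_poly n) (-1) = fact n"
    by (simp only: of_int_eq_iff)
  thus ?thesis
    using norm_num_at_i[of \<i> n] norm_num_at_i[of "-\<i>" n] norm_num_at_sixth_root[of _ n] by simp
qed

end
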